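(* Let $\mathcal{C}$ be a finite non-empty collection of classical truth valuations (maps from propositional letters to $\{0,1\}$), and let $\bar p:\mathcal{C}\to[0,1]$ satisfy $\sum_{v\in\mathcal{C}}\bar p(v)=1$. Let $\varphi$ be a well-formed formula that is a classical tautology (true under every classical truth valuation). Then the logical measure of $\varphi$ satisfies $\mu(\varphi)>0$.
   Context: Formulas: propositional letters are formulas; if $\alpha,\beta$ are formulas then so are $(\alpha\vee\beta)$, $(\alpha\rightarrow\beta)$ and $(\neg\alpha)$ (other connectives such as $\wedge$ are abbreviations). Well-formed sequences (WFS) over $\mathcal{C}$: for each $v\in\mathcal{C}$, $\langle v\rangle$ (identified with $v$) is a WFS; if $s_i,s_j$ are WFS then $\langle s_i,s_j\rangle$ is a WFS; nothing else is. Association: a propositional letter $A$ is associated with every $\langle v\rangle$, $v\in\mathcal{C}$; if $\beta$ is associated with $s$ then $(\neg\beta)$ is associated with $s$; if $\alpha$ is associated with $s_i$ and $\beta$ with $s_j$ then $(\alpha\vee\beta)$ and $(\alpha\rightarrow\beta)$ are associated with $\langle s_i,s_j\rangle$. Let $A_\varphi$ denote the (finite) set of WFS associated with $\varphi$. Justification (for $s$ associated with the formula in question, with $s_i$ associated with $\alpha$ and $s_j$ with $\beta$): $\langle v\rangle$ justifies a letter $A$ iff $v(A)=1$; $s$ justifies $(\neg\alpha)$ iff $s$ does not justify $\alpha$; $\langle s_i,s_j\rangle$ justifies $(\alpha\rightarrow\beta)$ iff $s_i$ does not justify $\alpha$ or $s_j$ justifies $\beta$; $\langle s_i,s_j\rangle$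 justifies $(\alpha\vee\beta)$ iff $s_i$ justifies $\alpha$ or $s_j$ justifies $\beta$. Let $J_\varphi\subseteq A_\varphi$ be the set of associated sequences that justify $\varphi$. Weight: $p(\langle v\rangle)=\bar p(v)$ and $p(\langle s_i,s_j\rangle)=p(s_i)\,p(s_j)$. Logical measure: $\mu(\varphi)=\sum_{s\in J_\varphi}p(s)$ (written $P(\varphi)$ in the paper's theorem statement). *)

theory Defs
  imports Complex_Main
begin

datatype 'a form =
    Letter 'a
  | Or "'a form" "'a form"
  | Imp "'a form" "'a form"
  | Neg "'a form"

text \<open>Truth values 1 and 0 are rendered as \<^const>\<open>True\<close> and \<^const>\<open>False\<close>.\<close>

type_synonym 'a valuation = "'a \<Rightarrow> bool"

primrec eval :: "'a valuation \<Rightarrow> 'a form \<Rightarrow> bool" where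
  "eval v (Letter A) \<longleftrightarrow> v A"
| "eval v (Or \<alpha> \<beta>) \<longleftrightarrow> eval v \<alpha> \<or> eval v \<beta>"
| "eval v (Imp \<alpha> \<beta>) \<longleftrightarrow> (eval v \<alpha> \<longrightarrow> eval v \<beta>)"
| "eval v (Neg \<alpha>) \<longleftrightarrow> \<not> eval v \<alpha>"

definition tautology :: "'a form \<Rightarrow> bool" where
  "tautology \<phi> \<longleftrightarrow> (\<forall>v. eval v \<phi>)"

datatype 'v wfseq = Single 'v | Join "'v wfseq" "'v wfseq"

inductive_set WFS :: "'v set \<Rightarrow> 'v wfseq set" for C :: "'v set" where
  single: "v \<in> C \<Longrightarrow> Single v \<in> WFS C"
| join: "s \<in> WFS C \<Longrightarrow> t \<in> WFS C \<Longrightarrow> Join s t \<in> WFS C"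

inductive associated :: "'a valuation set \<Rightarrow> 'a form \<Rightarrow> 'a valuation wfseq \<Rightarrow> bool"
  for C :: "'a valuation set" where
  letter: "v \<in> C \<Longrightarrow> associated C (Letter A) (Single v)"
| neg: "associated C \<beta> s \<Longrightarrow> associated C (Neg \<beta>) s"
| disj: "associated C \<alpha> s \<Longrightarrow> associated C \<beta> t \<Longrightarrow> associated C (Or \<alpha> \<beta>) (Join s t)"
| imp: "associated C \<alpha> s \<Longrightarrow> associated C \<beta> t \<Longrightarrow> associated C (Imp \<alpha> \<beta>) (Join s t)"

definition assoc_seqs :: "'a valuation set \<Rightarrow> 'a form \<Rightarrow> 'a valuation wfseq set" where
  "assoc_seqs C \<phi> = {s \<in> WFS C. associated C \<phi> s}"

text \<open>Justification is only meaningful for a sequence associated with the formula; the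
  last equation is a dummy value for mismatched shapes and is irrelevant to
  \<open>justifying_seqs\<close> below.\<close>

fun justifies :: "'a valuation wfseq \<Rightarrow> 'a form \<Rightarrow> bool" where
  "justifies (Single v) (Letter A) \<longleftrightarrow> v A"
| "justifies s (Neg \<alpha>) \<longleftrightarrow> \<not> justifies s \<alpha>"
| "justifies (Join s t) (Imp \<alpha> \<beta>) \<longleftrightarrow> \<not> justifies s \<alpha> \<or> justifies t \<beta>"
| "justifies (Join s t) (Or \<alpha> \<beta>) \<longleftrightarrow> justifies s \<alpha> \<or> justifies t \<beta>"
| "justifies _ _ \<longleftrightarrow> False"

definition justifying_seqs :: "'a valuation set \<Rightarrow> 'a form \<Rightarrow> 'a valuation wfseq set" where
  "justifying_seqs C \<phi> = {s \<in> assoc_seqs C \<phi>. justifies s \<phi>}"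

primrec weight :: "('v \<Rightarrow> real) \<Rightarrow> 'v wfseq \<Rightarrow> real" where
  "weight p (Single v) = p v"
| "weight p (Join s t) = weight p s * weight p t"

definition logical_measure ::
    "'a valuation set \<Rightarrow> ('a valuation \<Rightarrow> real) \<Rightarrow> 'a form \<Rightarrow> real" where
  "logical_measure C p \<phi> = (\<Sum>s\<in>justifying_seqs C \<phi>. weight p s)"

text \<open>For finite \<open>C\<close> the sum above ranges over a finite set, so it never takes the default
  value of \<^const>\<open>sum\<close> on infinite sets.\<close>

lemma finite_associated:
  assumes "finite C"
  shows "finite {s. associated C \<phi> s}"
proof (induction \<phi>)
  case (Letter A)
  have "{s. associated C (Letter A) s} \<subseteq> Single ` C"
    by (auto elim: associated.cases)
  then show ?case
    using assms finite_subset by blast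
next
  case (Or \<alpha> \<beta>)
  have "{s. associated C (Or \<alpha> \<beta>) s} \<subseteq>
      (\<lambda>(s, t). Join s t) ` ({s. associated C \<alpha> s} \<times> {s. associated C \<beta> s})"
    by (auto elim: associated.cases)
  then show ?case
    by (rule finite_subset) (use Or in auto)
next
  case (Imp \<alpha> \<beta>)
  have "{s. associated C (Imp \<alpha> \<beta>) s} \<subseteq>
      (\<lambda>(s, t). Join s t) ` ({s. associated C \<alpha> s} \<times> {s. associated C \<beta> s})"
    by (auto elim: associated.cases)
  then show ?case
    by (rule finite_subset) (use Imp in auto)
next
  case (Neg \<alpha>)
  have "{s. associated C (Neg \<alpha>) s} \<subseteq> {s. associated C \<alpha> s}"
    by (auto elim: associated.cases)
  then show ?case
    using Neg finite_subset by blast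
qed

lemma finite_justifying_seqs: "finite C \<Longrightarrow> finite (justifying_seqs C \<phi>)"
  unfolding justifying_seqs_def assoc_seqs_def
  by (rule finite_subset[OF _ finite_associated]) auto

end

theory Submission
  imports Defs
begin

text \<open>Some \<open>v \<in> C\<close> has positive probability. The associated sequence all of whose entries are
  \<open>v\<close> has positive weight, and it evaluates the formula exactly as the classical valuation \<open>v\<close>
  does, so it justifies every tautology. No other weight is negative.\<close>

text \<open>\<open>Neg\<close> adds no node: a formula and its negation have the same associated
  sequences.\<close>

primrec constant_seq :: "'v \<Rightarrow> 'a form \<Rightarrow> 'v wfseq" where
  "constant_seq v (Letter A) = Single v"
| "constant_seq v (Or \<alpha> \<beta>) = Join (constant_seq v \<alpha>) (constant_seq v \<beta>)"
| "constant_seq v (Imp \<alpha> \<beta>) = Join (constant_seq v \<alpha>) (constant_seq v \<beta>)"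
| "constant_seq v (Neg \<alpha>) = constant_seq v \<alpha>"

lemma constant_seq_in_WFS: "v \<in> C \<Longrightarrow> constant_seq v \<phi> \<in> WFS C"
  by (induction \<phi>) (auto intro: WFS.intros)

lemma associated_constant_seq: "v \<in> C \<Longrightarrow> associated C \<phi> (constant_seq v \<phi>)"
  by (induction \<phi>) (auto intro: associated.intros)

text \<open>An equivalence, because the \<open>Neg\<close> case swaps the two directions.\<close>

lemma justifies_constant_seq_iff: "justifies (constant_seq v \<phi>) \<phi> \<longleftrightarrow> eval v \<phi>"
  by (induction \<phi>) auto

text \<open>The weight is a power of \<open>p v\<close>, with one factor per letter
  occurrence.\<close>

lemma weight_constant_seq_pos: "0 < p v \<Longrightarrow> 0 < weight p (constant_seq v \<phi>)"
  by (induction \<phi>) auto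

text \<open>All entries of \<open>s\<close> lie in \<open>C\<close>; outside \<open>C\<close> the
  sign of \<open>p\<close> is unconstrained.\<close>

lemma weight_nonneg:
  assumes "s \<in> WFS C" and "\<And>v. v \<in> C \<Longrightarrow> 0 \<le> p v"
  shows "0 \<le> weight p s"
  using assms by (induction rule: WFS.induct) auto

theorem mainTheorem1:
  fixes C :: "'a valuation set"
    and p :: "'a valuation \<Rightarrow> real"
    and \<phi> :: "'a form"
  assumes "finite C"
    and "C \<noteq> {}"
    and "\<And>v. v \<in> C \<Longrightarrow> 0 \<le> p v \<and> p v \<le> 1"
    and "(\<Sum>v\<in>C. p v) = 1"
    and "tautology \<phi>"
  shows "logical_measure C p \<phi> > 0"
proof -
  \<comment> \<open>Otherwise every term of the sum over \<open>C\<close>, hence the sum 1 itself,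
    would be at most 0.\<close>
  obtain v where v: "v \<in> C" "0 < p v"
    using assms(4) sum_nonpos[of C p] by (metis not_le not_one_le_zero)
  have "constant_seq v \<phi> \<in> justifying_seqs C \<phi>"
    using v(1) assms(5)
    by (simp add: justifying_seqs_def assoc_seqs_def constant_seq_in_WFS associated_constant_seq
        justifies_constant_seq_iff tautology_def)
  moreover have "0 < weight p (constant_seq v \<phi>)"
    by (rule weight_constant_seq_pos) (rule v(2))
  moreover have "0 \<le> weight p s" if "s \<in> justifying_seqs C \<phi>" for s
    using that assms(3) by (auto simp: justifying_seqs_def assoc_seqs_def intro: weight_nonneg)
  ultimately show ?thesis
    unfolding logical_measure_def
    \<comment> \<open>Over an infinite index set the sum would default to 0.\<close>
    using finite_justifying_seqs[OF assms(1)] by (intro sum_pos2)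
qed

end
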